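(* Let $n\ge 1$. Among triangle-free graphs of order $n$, the balanced complete bipartite graph $K_{\lfloor n/2\rfloor,\lceil n/2\rceil}$ uniquely maximizes the number of subpaths. That is, every triangle-free graph $G$ of order $n$ satisfies $$\mathrm{pn}(G)\le \mathrm{pn}\bigl(K_{\lfloor n/2\rfloor,\lceil n/2\rceil}\bigr),$$ with equality if and only if $G\cong K_{\lfloor n/2\rfloor,\lceil n/2\rceil}$.
   Context: Graphs are finite and simple; the order of a graph is its number of vertices. For a graph $G$ of order $n$, the number of subpaths (path number) is $\mathrm{pn}(G)=\sum_{i=0}^{n-1}\mathrm{pn}_i(G)$, where $\mathrm{pn}_i(G)$ is the number of (not necessarily induced) subgraphs of $G$ isomorphic to the path $P_{i+1}$ on $i+1$ vertices (so paths are unoriented and single vertices count as paths of length $0$). *)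

theory Defs
  imports Main
begin

text \<open>A graph is a pair of a vertex set and a set of edges, each edge being the
  two-element set of its ends.\<close>

type_synonym 'a ugraph = "'a set \<times> 'a set set"

abbreviation verts :: "'a ugraph \<Rightarrow> 'a set" where
  "verts G \<equiv> fst G"

abbreviation edges :: "'a ugraph \<Rightarrow> 'a set set" where
  "edges G \<equiv> snd G"

definition simple_graph :: "'a ugraph \<Rightarrow> bool" where
  "simple_graph G \<longleftrightarrow> finite (verts G) \<and> (\<forall>e\<in>edges G. e \<subseteq> verts G \<and> card e = 2)"

definition order :: "'a ugraph \<Rightarrow> nat" where
  "order G = card (verts G)"

definition subgraph :: "'a ugraph \<Rightarrow> 'a ugraph \<Rightarrow> bool" where
  "subgraph H G \<longleftrightarrow> simple_graph H \<and> verts H \<subseteq> verts G \<and> edges H \<subseteq> edges G"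

definition graph_iso :: "'a ugraph \<Rightarrow> 'b ugraph \<Rightarrow> bool" where
  "graph_iso G H \<longleftrightarrow> (\<exists>f. bij_betw f (verts G) (verts H) \<and>
     (\<forall>u\<in>verts G. \<forall>v\<in>verts G. {u, v} \<in> edges G \<longleftrightarrow> {f u, f v} \<in> edges H))"

text \<open>For simple graphs the three vertices below are automatically distinct, as
  singletons are not edges.\<close>

definition triangle_free :: "'a ugraph \<Rightarrow> bool" where
  "triangle_free G \<longleftrightarrow>
     \<not> (\<exists>u v w. {u, v} \<in> edges G \<and> {v, w} \<in> edges G \<and> {u, w} \<in> edges G)"

text \<open>The parameter of \<open>path_graph\<close> is the number of vertices, not the length.\<close>

definition path_graph :: "nat \<Rightarrow> nat ugraph" where
  "path_graph k = ({..<k}, {{i, Suc i} | i. Suc i < k})"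

definition complete_bipartite :: "nat \<Rightarrow> nat \<Rightarrow> nat ugraph" where
  "complete_bipartite a b =
     ({..<a + b}, {{u, v} | u v. u \<in> {..<a} \<and> v \<in> {a..<a + b}})"

definition pn_len :: "nat \<Rightarrow> 'a ugraph \<Rightarrow> nat" where
  "pn_len i G = card {H. subgraph H G \<and> graph_iso H (path_graph (i + 1))}"

definition pn :: "'a ugraph \<Rightarrow> nat" where
  "pn G = (\<Sum>i<order G. pn_len i G)"

lemma simple_graph_complete_bipartite: "simple_graph (complete_bipartite a b)"
  by (auto simp: simple_graph_def complete_bipartite_def card_insert_if)

lemma order_complete_bipartite: "order (complete_bipartite a b) = a + b"
  by (simp add: order_def complete_bipartite_def)

lemma triangle_free_complete_bipartite: "triangle_free (complete_bipartite a b)"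
proof -
  have "x < a \<longleftrightarrow> \<not> y < a" if "{x, y} \<in> edges (complete_bipartite a b)" for x y
    using that by (auto simp: complete_bipartite_def doubleton_eq_iff)
  then show ?thesis unfolding triangle_free_def by blast
qed

end

theory Submission
  imports Defs
begin

text \<open>Count paths as lists of vertices; every subgraph isomorphic to a path on \<open>k\<close> vertices
  arises from the same positive number of lists, so lists may replace subgraphs. A path on
  \<open>k + 2\<close> vertices, \<open>k \<ge> 1\<close>, consists of an edge followed by a path on \<open>k\<close> vertices avoiding it,
  and in a triangle-free graph only one orientation of the edge can be attached. By Mantel's theorem
  there are at most \<open>n\<^sup>2 div 4\<close> edges, and the remaining graph is triangle-free on
  \<open>n - 2\<close> vertices, so induction bounds the number of paths of each length; in the balanced complete
  bipartite graph every step is an equality. If the totals agree, then so do the numbers of paths of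
  length one, that is, of edges, and the equality case of Mantel's theorem determines the graph.\<close>

section \<open>Paths as lists of distinct vertices\<close>

definition adj :: "'a ugraph \<Rightarrow> 'a \<Rightarrow> 'a \<Rightarrow> bool" where
  "adj G u v \<longleftrightarrow> {u, v} \<in> edges G"

text \<open>For symmetric \<open>E\<close>, a path on at least two vertices is listed twice, once
  from each end; \<open>card_paths_eq\<close> accounts for this multiplicity.\<close>

definition paths :: "('a \<Rightarrow> 'a \<Rightarrow> bool) \<Rightarrow> 'a set \<Rightarrow> nat \<Rightarrow> 'a list set" where
  "paths E V k = {xs. distinct xs \<and> set xs \<subseteq> V \<and> length xs = k \<and> successively E xs}"

definition list_graph :: "'a list \<Rightarrow> 'a ugraph" where
  "list_graph xs = (set xs, {{xs ! i, xs ! Suc i} | i. Suc i < length xs})"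

definition list_reps :: "nat \<Rightarrow> 'a ugraph \<Rightarrow> 'a list set" where
  "list_reps k H = {xs. distinct xs \<and> length xs = k \<and> list_graph xs = H}"

lemma finite_paths: "finite V \<Longrightarrow> finite (paths E V k)"
  by (rule finite_subset[OF _ finite_lists_length_eq[of V k]]) (auto simp: paths_def)

lemma successively_iff_nth:
  "successively P xs \<longleftrightarrow> (\<forall>i. Suc i < length xs \<longrightarrow> P (xs ! i) (xs ! Suc i))"
proof (induction P xs rule: successively.induct)
  case (3 P x y xs)
  then show ?case by (auto simp: nth_Cons split: nat.splits)
qed auto

lemma path_graph_eq_list_graph: "path_graph k = list_graph [0..<k]"
proof -
  have "{{i, Suc i} | i. Suc i < k} = {{[0..<k] ! i, [0..<k] ! Suc i} | i. Suc i < k}"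
    by (intro Collect_cong ex_cong1) auto
  then show ?thesis by (simp add: path_graph_def list_graph_def lessThan_atLeast0)
qed

lemma list_graph_map:
  "list_graph (map f xs) = (f ` set xs, (`) f ` edges (list_graph xs))"
proof -
  have "{{map f xs ! i, map f xs ! Suc i} |i. Suc i < length xs}
      = {f ` {xs ! i, xs ! Suc i} |i. Suc i < length xs}"
    by (intro Collect_cong ex_cong1) auto
  also have "\<dots> = (`) f ` {{xs ! i, xs ! Suc i} |i. Suc i < length xs}" by blast
  finally show ?thesis by (simp add: list_graph_def)
qed

lemma list_graph_map_cong:
  assumes "list_graph xs = list_graph ys"
  shows "list_graph (map f xs) = list_graph (map f ys)"
proof -
  have "set xs = set ys" using arg_cong[OF assms, of fst] by (simp add: list_graph_def)
  then show ?thesis by (simp only: list_graph_map assms)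
qed

lemma subgraph_list_graph_iff:
  assumes "distinct xs"
  shows "subgraph (list_graph xs) G \<longleftrightarrow> xs \<in> paths (adj G) (verts G) (length xs)"
proof -
  have "simple_graph (list_graph xs)"
    using assms by (auto simp: simple_graph_def list_graph_def card_insert_if nth_eq_iff_index_eq)
  moreover have "edges (list_graph xs) \<subseteq> edges G \<longleftrightarrow> successively (adj G) xs"
    by (auto simp: list_graph_def successively_iff_nth adj_def)
  ultimately show ?thesis
    using assms by (simp add: subgraph_def paths_def) (simp add: list_graph_def)
qed

text \<open>An isomorphism onto the standard path and a list tracing \<open>H\<close> carry the same
  data: list the preimages of 0, 1, ... in order, or send each vertex to its position in the
  list.\<close>

lemma graph_iso_path_graph_iff:
  assumes H: "simple_graph H"
  shows "graph_iso H (path_graph k) \<longleftrightarrow> list_reps k H \<noteq> {}"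
proof
  assume "graph_iso H (path_graph k)"
  then obtain f where f: "bij_betw f (verts H) {..<k}"
    and e: "\<And>u v. u \<in> verts H \<Longrightarrow> v \<in> verts H \<Longrightarrow>
              {u, v} \<in> edges H \<longleftrightarrow> {f u, f v} \<in> edges (path_graph k)"
    unfolding graph_iso_def by (auto simp: path_graph_def)
  define g where "g = inv_into (verts H) f"
  have g: "bij_betw g {..<k} (verts H)" unfolding g_def by (rule bij_betw_inv_into[OF f])
  have fg: "f (g i) = i" if "i < k" for i
    unfolding g_def by (rule bij_betw_inv_into_right[OF f]) (use that in simp)
  have gf: "g (f v) = v" if "v \<in> verts H" for v
    unfolding g_def by (rule bij_betw_inv_into_left[OF f that])
  have gH: "g i \<in> verts H" if "i < k" for i using g that by (auto simp: bij_betw_def)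
  have "edges H = {{g i, g (Suc i)} | i. Suc i < k}"
  proof (intro set_eqI iffI)
    fix d assume d: "d \<in> edges H"
    then have "card d = 2" "d \<subseteq> verts H" using H by (auto simp: simple_graph_def)
    then obtain u v where uv: "d = {u, v}" "u \<in> verts H" "v \<in> verts H"
      by (auto simp: card_2_iff)
    then have "{f u, f v} \<in> edges (path_graph k)" using d e by simp
    then obtain i where i: "Suc i < k" "{f u, f v} = {i, Suc i}" by (auto simp: path_graph_def)
    have "d = g ` {f u, f v}" using uv gf by simp
    also have "\<dots> = {g i, g (Suc i)}" unfolding i by simp
    finally show "d \<in> {{g i, g (Suc i)} | i. Suc i < k}" using i by blast
  next
    fix d assume "d \<in> {{g i, g (Suc i)} | i. Suc i < k}"
    then obtain i where i: "Suc i < k" "d = {g i, g (Suc i)}" by blast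
    have "{f (g i), f (g (Suc i))} \<in> edges (path_graph k)"
      using i fg by (auto simp: path_graph_def)
    then show "d \<in> edges H" using e[of "g i" "g (Suc i)"] gH i by simp
  qed
  moreover have "{{g i, g (Suc i)} | i. Suc i < k} = edges (list_graph (map g [0..<k]))"
    unfolding list_graph_def by (simp, intro Collect_cong ex_cong1) auto
  moreover have "verts H = verts (list_graph (map g [0..<k]))"
    using g by (auto simp: list_graph_def bij_betw_def lessThan_atLeast0)
  ultimately have "list_graph (map g [0..<k]) = H" by (simp add: prod_eq_iff)
  moreover have "distinct (map g [0..<k])"
    using g by (simp add: distinct_map bij_betw_def lessThan_atLeast0)
  ultimately show "list_reps k H \<noteq> {}"
    unfolding list_reps_def by (metis (mono_tags, lifting) diff_zero empty_iff length_map length_upt mem_Collect_eq)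
next
  assume "list_reps k H \<noteq> {}"
  then obtain xs where xs: "distinct xs" "length xs = k" "list_graph xs = H"
    by (auto simp: list_reps_def)
  define f where "f = inv_into {..<k} ((!) xs)"
  have nth: "bij_betw ((!) xs) {..<k} (verts H)"
    using xs by (intro bij_betw_nth) (auto simp: list_graph_def)
  have f: "bij_betw f (verts H) {..<k}" unfolding f_def by (rule bij_betw_inv_into[OF nth])
  have "{u, v} \<in> edges H \<longleftrightarrow> {f u, f v} \<in> edges (path_graph k)"
    if uv: "u \<in> verts H" "v \<in> verts H" for u v
  proof -
    obtain a b where ab: "a < k" "b < k" "u = xs ! a" "v = xs ! b"
      using uv nth unfolding bij_betw_def by (metis imageE lessThan_iff)
    then have fu: "f u = a" "f v = b"
      unfolding f_def using bij_betw_inv_into_left[OF nth] by auto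
    have "{u, v} \<in> edges H \<longleftrightarrow> (\<exists>i. Suc i < k \<and> {u, v} = {xs ! i, xs ! Suc i})"
      using xs by (auto simp: list_graph_def)
    also have "\<dots> \<longleftrightarrow> (\<exists>i. Suc i < k \<and> {a, b} = {i, Suc i})"
      unfolding doubleton_eq_iff using ab xs by (intro ex_cong1) (auto simp: nth_eq_iff_index_eq)
    finally show ?thesis unfolding fu by (auto simp: path_graph_def)
  qed
  then show "graph_iso H (path_graph k)"
    unfolding graph_iso_def using f by (auto simp: path_graph_def)
qed

section \<open>From subgraphs to lists: a common multiplicity\<close>

lemma set_list_reps: "xs \<in> list_reps k H \<Longrightarrow> set xs = verts H"
  by (auto simp: list_reps_def list_graph_def)

lemma length_list_reps: "xs \<in> list_reps k H \<Longrightarrow> length xs = k"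
  by (simp add: list_reps_def)

lemma verts_path_graph: "verts (path_graph k) = {..<k}"
  by (simp add: path_graph_def)

text \<open>Relabelling along one tracing list \<open>xs\<close> matches the lists tracing the
  standard path with those tracing \<open>H\<close>. The common number is never computed; it only
  has to be positive in order to cancel.\<close>

lemma card_list_reps:
  assumes "list_reps k H \<noteq> {}"
  shows "card (list_reps k H) = card (list_reps k (path_graph k))"
proof -
  obtain xs where xs_rep: "xs \<in> list_reps k H" using assms by blast
  then have xs: "distinct xs" "length xs = k" "list_graph xs = H" by (auto simp: list_reps_def)
  define f where "f = (!) xs"
  define g where "g = inv_into {..<k} f"
  have f: "bij_betw f {..<k} (set xs)"
    unfolding f_def using xs by (intro bij_betw_nth) auto
  have xs_map: "map f [0..<k] = xs" unfolding f_def using xs(2) map_nth by blast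
  have verts: "set ys = {..<k}" if "ys \<in> list_reps k (path_graph k)" for ys
    using set_list_reps[OF that] by (simp add: verts_path_graph)
  have vertsH: "set ys = set xs" if "ys \<in> list_reps k H" for ys
    using that xs_rep by (simp only: set_list_reps)
  have g: "bij_betw g (set xs) {..<k}" unfolding g_def by (rule bij_betw_inv_into[OF f])
  have gf: "g (f i) = i" if "i < k" for i
    unfolding g_def by (rule bij_betw_inv_into_left[OF f]) (use that in simp)
  have fg: "f (g v) = v" if "v \<in> set xs" for v
    unfolding g_def by (rule bij_betw_inv_into_right[OF f that])
  have "bij_betw (map f) (list_reps k (path_graph k)) (list_reps k H)"
  proof (rule bij_betw_byWitness[where f' = "map g"])
    show "\<forall>ys\<in>list_reps k (path_graph k). map g (map f ys) = ys"
      using gf verts by (auto intro!: map_idI)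
    show "\<forall>ys\<in>list_reps k H. map f (map g ys) = ys"
      using fg vertsH by (auto intro!: map_idI)
    show "map f ` list_reps k (path_graph k) \<subseteq> list_reps k H"
    proof (rule image_subsetI)
      fix ys assume ys: "ys \<in> list_reps k (path_graph k)"
      then have "list_graph ys = list_graph [0..<k]"
        by (simp add: list_reps_def path_graph_eq_list_graph)
      then have "list_graph (map f ys) = H"
        using list_graph_map_cong[of ys "[0..<k]" f] xs xs_map by simp
      moreover have "distinct (map f ys)"
        using f ys verts[OF ys] by (simp add: distinct_map bij_betw_def list_reps_def)
      ultimately show "map f ys \<in> list_reps k H" using ys by (simp add: list_reps_def)
    qed
    show "map g ` list_reps k H \<subseteq> list_reps k (path_graph k)"
    proof (rule image_subsetI)
      fix ys assume ys: "ys \<in> list_reps k H"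
      have "map g xs = [0..<k]" unfolding xs_map[symmetric] using gf by (auto intro!: map_idI)
      then have "list_graph (map g ys) = path_graph k"
        using list_graph_map_cong[of ys xs g] xs ys
        by (simp add: list_reps_def path_graph_eq_list_graph)
      moreover have "distinct (map g ys)"
        using g ys vertsH[OF ys] by (simp add: distinct_map bij_betw_def list_reps_def)
      ultimately show "map g ys \<in> list_reps k (path_graph k)" using ys by (simp add: list_reps_def)
    qed
  qed
  then show ?thesis by (simp add: bij_betw_same_card)
qed

lemma card_list_reps_path_graph_pos: "0 < card (list_reps k (path_graph k))"
proof -
  have "list_reps k (path_graph k) \<subseteq> {ys. set ys \<subseteq> {..<k} \<and> length ys = k}"
    by (intro subsetI CollectI conjI equalityD1)
      (simp_all only: set_list_reps length_list_reps verts_path_graph)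
  then have "finite (list_reps k (path_graph k))"
    using finite_lists_length_eq[of "{..<k}" k] finite_subset by blast
  moreover have "[0..<k] \<in> list_reps k (path_graph k)"
    by (simp add: list_reps_def path_graph_eq_list_graph)
  ultimately show ?thesis using card_gt_0_iff by blast
qed

text \<open>Group the path lists by the subgraph they trace: the groups are indexed by exactly the
  subgraphs counted in \<open>pn_len\<close>, and all have the same size.\<close>

lemma card_paths_eq:
  assumes G: "simple_graph G"
  shows "card (paths (adj G) (verts G) (Suc i))
           = card (list_reps (Suc i) (path_graph (Suc i))) * pn_len i G"
proof -
  let ?P = "paths (adj G) (verts G) (Suc i)"
  have fin: "finite ?P" using G by (intro finite_paths) (simp add: simple_graph_def)
  have im: "{H. subgraph H G \<and> graph_iso H (path_graph (i + 1))} = list_graph ` ?P"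
  proof (intro set_eqI iffI)
    fix H assume "H \<in> {H. subgraph H G \<and> graph_iso H (path_graph (i + 1))}"
    then have H: "subgraph H G" "graph_iso H (path_graph (Suc i))" by auto
    then have "list_reps (Suc i) H \<noteq> {}"
      using graph_iso_path_graph_iff[of H "Suc i"] by (simp add: subgraph_def)
    then obtain xs where "distinct xs" "length xs = Suc i" "list_graph xs = H"
      by (auto simp: list_reps_def)
    then show "H \<in> list_graph ` ?P" using subgraph_list_graph_iff[of xs G] H by auto
  next
    fix H assume "H \<in> list_graph ` ?P"
    then obtain xs where xs: "xs \<in> ?P" "H = list_graph xs" by (rule imageE)
    then have d: "distinct xs" "length xs = Suc i" by (auto simp: paths_def)
    have "subgraph H G" using subgraph_list_graph_iff[of xs G] d xs by simp
    moreover have "list_reps (Suc i) H \<noteq> {}" using d xs by (auto simp: list_reps_def)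
    ultimately show "H \<in> {H. subgraph H G \<and> graph_iso H (path_graph (i + 1))}"
      using graph_iso_path_graph_iff[of H "Suc i"] by (simp add: subgraph_def)
  qed
  have fibre: "card {xs \<in> ?P. list_graph xs = H} = card (list_reps (Suc i) (path_graph (Suc i)))"
    if "H \<in> list_graph ` ?P" for H
  proof -
    from that obtain xs where xs: "xs \<in> ?P" "H = list_graph xs" by (rule imageE)
    have d: "distinct xs" "length xs = Suc i" using xs by (auto simp: paths_def)
    then have "subgraph H G" using subgraph_list_graph_iff[of xs G] xs by simp
    \<comment> \<open>Whether a list tracing \<open>H\<close> lies in \<open>?P\<close> depends only
      on \<open>H\<close> being a subgraph, so one such list in \<open>?P\<close> brings all the
      others with it.\<close>
    then have "ys \<in> ?P" if "ys \<in> list_reps (Suc i) H" for ys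
      using subgraph_list_graph_iff[of ys G] that by (simp add: list_reps_def)
    then have "{ys \<in> ?P. list_graph ys = H} = list_reps (Suc i) H"
      by (intro set_eqI iffI) (simp_all add: list_reps_def paths_def)
    then have "card {ys \<in> ?P. list_graph ys = H} = card (list_reps (Suc i) H)" by (rule arg_cong)
    also have "\<dots> = card (list_reps (Suc i) (path_graph (Suc i)))"
      by (rule card_list_reps) (use d xs(2) in \<open>auto simp: list_reps_def\<close>)
    finally show ?thesis .
  qed
  have "card ?P = (\<Sum>xs\<in>?P. 1)" by (rule card_eq_sum)
  also have "\<dots> = (\<Sum>H\<in>list_graph ` ?P. \<Sum>xs | xs \<in> ?P \<and> list_graph xs = H. 1)"
    by (rule sum.image_gen[OF fin])
  also have "\<dots> = (\<Sum>H\<in>list_graph ` ?P. card (list_reps (Suc i) (path_graph (Suc i))))"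
    unfolding card_eq_sum[symmetric] by (intro sum.cong refl fibre)
  finally show ?thesis unfolding pn_len_def im sum_constant of_nat_id by (simp only: mult.commute)
qed

section \<open>Path counts of complete bipartite graphs\<close>

text \<open>\<open>alt_paths A B k\<close> lists the \<open>k\<close>-vertex paths of the complete bipartite graph with parts
  \<open>A\<close> and \<open>B\<close> that start in \<open>A\<close>.\<close>

fun alt_paths :: "'a set \<Rightarrow> 'a set \<Rightarrow> nat \<Rightarrow> 'a list set" where
  "alt_paths A B 0 = {[]}" |
  "alt_paths A B (Suc k) = (\<Union>x\<in>A. (#) x ` alt_paths B (A - {x}) k)"

text \<open>This is the product \<open>a * b * (a - 1) * (b - 1) * ...\<close> with \<open>k\<close>
  factors. Truncated subtraction is harmless: where it truncates, the factor 0 has already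
  occurred.\<close>

fun alt_count :: "nat \<Rightarrow> nat \<Rightarrow> nat \<Rightarrow> nat" where
  "alt_count a b 0 = 1" |
  "alt_count a b (Suc k) = a * alt_count b (a - 1) k"

text \<open>For \<open>k > 0\<close> the summands separate the paths by the part in which they
  start. At \<open>k = 0\<close> the value is 2, not 1, which is what lets
  \<open>bip_count_Suc_Suc\<close> hold there and count every edge in both directions.\<close>

definition bip_count :: "nat \<Rightarrow> nat \<Rightarrow> nat" where
  "bip_count n k = alt_count (n div 2) ((n + 1) div 2) k + alt_count ((n + 1) div 2) (n div 2) k"

lemma finite_alt_paths: "finite A \<Longrightarrow> finite B \<Longrightarrow> finite (alt_paths A B k)"
  by (induction k arbitrary: A B) auto

lemma card_alt_paths:
  "finite A \<Longrightarrow> finite B \<Longrightarrow> card (alt_paths A B k) = alt_count (card A) (card B) k"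
proof (induction k arbitrary: A B)
  case (Suc k)
  have "card (alt_paths A B (Suc k)) = (\<Sum>x\<in>A. card ((#) x ` alt_paths B (A - {x}) k))"
    unfolding alt_paths.simps using Suc.prems
    by (intro card_UN_disjoint) (auto simp: finite_alt_paths)
  also have "\<dots> = (\<Sum>x\<in>A. alt_count (card B) (card A - 1) k)"
    by (rule sum.cong[OF refl]) (use Suc in \<open>simp add: card_image\<close>)
  finally show ?case by simp
qed simp

lemma alt_paths_subset_paths:
  assumes "A \<inter> B = {}" and "\<And>x y. x \<in> A \<Longrightarrow> y \<in> B \<Longrightarrow> E x y \<and> E y x"
  shows "alt_paths A B k \<subseteq> paths E (A \<union> B) k"
  using assms
proof (induction k arbitrary: A B)
  case (Suc k)
  have "x # xs \<in> paths E (A \<union> B) (Suc k)"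
    if x: "x \<in> A" and xs: "xs \<in> alt_paths B (A - {x}) k" for x xs
  proof -
    have "xs \<in> paths E (B \<union> (A - {x})) k"
      using Suc.IH[of B "A - {x}"] Suc.prems xs by blast
    \<comment> \<open>The tail starts in the opposite part, so its first vertex is adjacent to
      \<open>x\<close>.\<close>
    moreover have "xs = [] \<or> hd xs \<in> B" using xs by (cases k) auto
    ultimately show ?thesis
      using Suc.prems x by (auto simp: paths_def successively_Cons)
  qed
  then show ?case by auto
qed (simp add: paths_def)

text \<open>The first vertex tells the two sets apart; at length 0 both would contain the empty
  list.\<close>

lemma alt_paths_disjoint:
  assumes "A \<inter> B = {}"
  shows "alt_paths A B (Suc k) \<inter> alt_paths B A (Suc k) = {}"
  using assms by auto

text \<open>\<open>E\<close> may hold inside \<open>A\<close> or \<open>B\<close> as well, hence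
  only an inequality. The reverse bound for the extremal graph comes from triangle-freeness in
  \<open>card_paths_turan\<close>.\<close>

lemma card_paths_bipartite_ge:
  assumes "finite A" "finite B" "A \<inter> B = {}"
    and E: "\<And>x y. x \<in> A \<Longrightarrow> y \<in> B \<Longrightarrow> E x y \<and> E y x"
  shows "alt_count (card A) (card B) (Suc k) + alt_count (card B) (card A) (Suc k)
           \<le> card (paths E (A \<union> B) (Suc k))"
proof -
  have "alt_paths A B (Suc k) \<subseteq> paths E (A \<union> B) (Suc k)"
    by (rule alt_paths_subset_paths) (use assms in auto)
  moreover have "alt_paths B A (Suc k) \<subseteq> paths E (B \<union> A) (Suc k)"
    by (rule alt_paths_subset_paths) (use assms in auto)
  ultimately have "card (alt_paths A B (Suc k) \<union> alt_paths B A (Suc k))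
      \<le> card (paths E (A \<union> B) (Suc k))"
    by (intro card_mono finite_paths) (use assms in \<open>auto simp: Un_commute\<close>)
  moreover have "card (alt_paths A B (Suc k) \<union> alt_paths B A (Suc k))
      = card (alt_paths A B (Suc k)) + card (alt_paths B A (Suc k))"
    by (intro card_Un_disjoint alt_paths_disjoint finite_alt_paths assms)
  ultimately show ?thesis
    using assms card_alt_paths[of A B "Suc k"] card_alt_paths[of B A "Suc k"] by linarith
qed

lemma half_mult_half: "(n div 2) * ((n + 1) div 2) = n * n div (4::nat)"
proof (cases "even n")
  case True
  then obtain m where "n = 2 * m" by (elim evenE)
  then show ?thesis by simp
next
  case False
  then obtain m where m: "n = 2 * m + 1" by (elim oddE)
  then have "n * n = (m * m + m) * 4 + 1" by (simp add: algebra_simps)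
  then have "n * n div 4 = m * m + m" by simp
  then show ?thesis using m by (simp add: algebra_simps)
qed

lemma bip_count_Suc_0: "bip_count n (Suc 0) = n"
  by (simp add: bip_count_def)

text \<open>The first two vertices use up one vertex of each part and leave balanced parts of total
  size \<open>n - 2\<close>. Both starting sides yield the same factor, the number of edges. For
  \<open>n < 2\<close> both sides vanish.\<close>

lemma bip_count_Suc_Suc: "bip_count n (Suc (Suc k)) = (n * n div 4) * bip_count (n - 2) k"
proof (cases "n \<ge> 2")
  case True
  then have "n div 2 - 1 = (n - 2) div 2" "(n + 1) div 2 - 1 = ((n - 2) + 1) div 2" by auto
  then show ?thesis
    unfolding bip_count_def half_mult_half[symmetric] by (simp add: algebra_simps)
next
  case False
  then have "n = 0 \<or> n = 1" by auto
  then show ?thesis by (auto simp: bip_count_def)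
qed

section \<open>Mantel's theorem with its equality case\<close>

definition arcs :: "('a \<Rightarrow> 'a \<Rightarrow> bool) \<Rightarrow> 'a set \<Rightarrow> ('a \<times> 'a) set" where
  "arcs E V = {(x, y). x \<in> V \<and> y \<in> V \<and> E x y}"

lemma finite_arcs: "finite V \<Longrightarrow> finite (arcs E V)"
  by (rule finite_subset[of _ "V \<times> V"]) (auto simp: arcs_def)

text \<open>With \<open>e = n - d\<close>, the identity \<open>4 * d * e + (d - e)^2 = n^2\<close>
  gives the bound. Rounding down loses less than 1 in the quotient, so equality forces
  \<open>(d - e)^2 < 4\<close>: the two parts differ by at most 1.\<close>

lemma mult_le_quarter_square:
  fixes d n :: nat
  assumes "d \<le> n"
  shows "d * (n - d) \<le> n * n div 4"
    and "d * (n - d) = n * n div 4 \<Longrightarrow> d = n div 2 \<or> n - d = n div 2"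
proof -
  obtain e where n: "n = d + e" using assms le_Suc_ex by blast
  have "int (4 * (d * e)) + (int d - int e)\<^sup>2 = int (n * n)"
    unfolding n by (simp add: power2_eq_square algebra_simps)
  moreover have "0 \<le> (int d - int e)\<^sup>2" by simp
  ultimately have "4 * (d * e) \<le> n * n" by linarith
  then show "d * (n - d) \<le> n * n div 4" using n by simp
  assume eq: "d * (n - d) = n * n div 4"
  have "m < 4 * (m div 4) + 4" for m :: nat by presburger
  from this[of "n * n"] have "n * n < 4 * (d * e) + 4" using eq n by simp
  then have "int (n * n) < int (4 * (d * e)) + 4" by linarith
  then have "(int d - int e)\<^sup>2 < 4"
    using \<open>int (4 * (d * e)) + (int d - int e)\<^sup>2 = int (n * n)\<close> by linarith
  then have "(int d - int e)\<^sup>2 < 2\<^sup>2" by simp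
  then have "\<bar>int d - int e\<bar> < 2" using power2_less_imp_less[of "\<bar>int d - int e\<bar>" 2] by simp
  then show "d = n div 2 \<or> n - d = n div 2" unfolding n by auto
qed

text \<open>The relation is fixed on the whole type and no vertex set is fixed, so deleting vertices
  in the induction changes only \<open>V\<close>.\<close>

locale triangle_free_relation =
  fixes E :: "'a \<Rightarrow> 'a \<Rightarrow> bool"
  assumes sym: "E x y \<Longrightarrow> E y x"
    and no_triangle: "E x y \<Longrightarrow> E y z \<Longrightarrow> \<not> E x z"
begin

lemma irrefl: "\<not> E x x"
  using no_triangle by blast

text \<open>Take \<open>N\<close> to be the neighbourhood of a vertex of maximum degree: it is independent, so every
  arc has an end outside \<open>N\<close>, and there are at most \<open>card N\<close> arcs in each direction at each vertex
  outside.\<close>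

lemma mantel:
  assumes V: "finite V"
  shows "\<exists>N\<subseteq>V. card (arcs E V) \<le> 2 * (card N * (card V - card N)) \<and>
    (card (arcs E V) = 2 * (card N * (card V - card N)) \<longrightarrow>
      (\<forall>x\<in>V. \<forall>y\<in>V. E x y \<longleftrightarrow> (x \<in> N \<longleftrightarrow> y \<notin> N)))"
proof (cases "V = {}")
  case True
  then show ?thesis by (simp add: arcs_def)
next
  case False
  define nb where "nb x = {y \<in> V. E x y}" for x
  define D where "D = Max ((\<lambda>x. card (nb x)) ` V)"
  have fin: "finite ((\<lambda>x. card (nb x)) ` V)" "(\<lambda>x. card (nb x)) ` V \<noteq> {}"
    using V False by auto
  then obtain v where v: "v \<in> V" "card (nb v) = D"
    using Max_in[OF fin] unfolding D_def by fastforce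
  define N where "N = nb v"
  define A where "A = V - N"
  have NV: "N \<subseteq> V" by (auto simp: N_def nb_def)
  have finN: "finite N" using NV V finite_subset by blast
  have finA: "finite A" using V by (simp add: A_def)
  have cardA: "card A = card V - card N"
    unfolding A_def using finN NV by (simp add: card_Diff_subset)
  have deg: "card (nb x) \<le> card N" if "x \<in> A" for x
    using that fin v by (auto simp: A_def N_def D_def)
  have ind: "\<not> E x y" if "x \<in> N" "y \<in> N" for x y
    using that no_triangle[of v x y] by (auto simp: N_def nb_def)
  \<comment> \<open>Arcs are sorted by their tail: those leaving \<open>A\<close> are counted by
    degrees, and those leaving \<open>N\<close> must end in \<open>A\<close> because
    \<open>N\<close> is independent.\<close>
  have split: "arcs E V = Sigma A nb \<union> (arcs E V \<inter> N \<times> A)"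
    using ind by (auto simp: arcs_def A_def nb_def)
  have disj: "Sigma A nb \<inter> (arcs E V \<inter> N \<times> A) = {}" by (auto simp: A_def)
  have "card (Sigma A nb) = (\<Sum>x\<in>A. card (nb x))"
    using finA V by (intro card_SigmaI) (auto simp: nb_def)
  also have "\<dots> \<le> (\<Sum>x\<in>A. card N)" by (rule sum_mono) (rule deg)
  finally have le1: "card (Sigma A nb) \<le> card N * card A" by (simp add: mult.commute)
  have le2: "card (arcs E V \<inter> N \<times> A) \<le> card (N \<times> A)"
    by (rule card_mono) (use finN finA in auto)
  have "card (arcs E V) = card (Sigma A nb) + card (arcs E V \<inter> N \<times> A)"
    by (subst split, rule card_Un_disjoint) (use disj finN finA V in \<open>auto simp: nb_def\<close>)
  then have le: "card (arcs E V) \<le> 2 * (card N * card A)"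
    and eq: "card (arcs E V) = 2 * (card N * card A) \<Longrightarrow> card (arcs E V \<inter> N \<times> A) = card (N \<times> A)"
    using le1 le2 by (auto simp: card_cartesian_product)
  have "\<forall>x\<in>V. \<forall>y\<in>V. E x y \<longleftrightarrow> (x \<in> N \<longleftrightarrow> y \<notin> N)" if "card (arcs E V) = 2 * (card N * card A)"
  proof -
    \<comment> \<open>Each of the two families of arcs has at most \<open>card N * card A\<close>
      members, so equality in the total fills \<open>N \<times> A\<close> completely.\<close>
    have "arcs E V \<inter> N \<times> A = N \<times> A"
      by (rule card_subset_eq) (use eq[OF that] finN finA in auto)
    then have full: "E x y" if "x \<in> N" "y \<in> A" for x y using that by (auto simp: arcs_def)
    \<comment> \<open>Adjacent vertices of \<open>A\<close> would form a triangle with any vertex of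
      \<open>N\<close>; if \<open>N\<close> is empty, the maximum degree is 0.\<close>
    have indA: "\<not> E x y" if xy: "x \<in> A" "y \<in> A" for x y
    proof (cases "N = {}")
      case True
      then show ?thesis using deg[OF xy(1)] V xy by (auto simp: nb_def A_def)
    next
      case False
      then obtain z where "z \<in> N" by blast
      then show ?thesis using full[of z x] full[of z y] no_triangle[of z x y] xy by blast
    qed
    show ?thesis using full ind indA sym unfolding A_def by blast
  qed
  then show ?thesis using NV le cardA by (intro exI[of _ N]) simp
qed

text \<open>The factor 2 reflects that \<open>arcs\<close> contains each edge in both
  directions.\<close>

lemma card_arcs_le:
  assumes "finite V"
  shows "card (arcs E V) \<le> 2 * (card V * card V div 4)"
proof -
  obtain N where "N \<subseteq> V" "card (arcs E V) \<le> 2 * (card N * (card V - card N))"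
    using mantel[OF assms] by blast
  moreover have "card N * (card V - card N) \<le> card V * card V div 4"
    by (rule mult_le_quarter_square) (use assms \<open>N \<subseteq> V\<close> card_mono in blast)
  ultimately show ?thesis by linarith
qed

lemma card_arcs_eq_imp_bipartite:
  assumes V: "finite V" and eq: "card (arcs E V) = 2 * (card V * card V div 4)"
  obtains P where "P \<subseteq> V" "card P = card V div 2"
    and "\<And>x y. x \<in> V \<Longrightarrow> y \<in> V \<Longrightarrow> E x y \<longleftrightarrow> (x \<in> P \<longleftrightarrow> y \<notin> P)"
proof -
  obtain N where N: "N \<subseteq> V" and le: "card (arcs E V) \<le> 2 * (card N * (card V - card N))"
    and bip: "card (arcs E V) = 2 * (card N * (card V - card N)) \<longrightarrow>
           (\<forall>x\<in>V. \<forall>y\<in>V. E x y \<longleftrightarrow> (x \<in> N \<longleftrightarrow> y \<notin> N))"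
    using mantel[OF V] by blast
  have cN: "card N \<le> card V" using V N card_mono by blast
  have "card N * (card V - card N) = card V * card V div 4"
    using mult_le_quarter_square(1)[OF cN] le eq by linarith
  then have half: "card N = card V div 2 \<or> card V - card N = card V div 2"
    and b: "\<forall>x\<in>V. \<forall>y\<in>V. E x y \<longleftrightarrow> (x \<in> N \<longleftrightarrow> y \<notin> N)"
    using mult_le_quarter_square(2)[OF cN] bip eq by auto
  have "card (V - N) = card V - card N"
    using N V by (meson card_Diff_subset finite_subset)
  \<comment> \<open>The bipartition condition is symmetric under complement in \<open>V\<close>, so
    whichever of \<open>N\<close> and \<open>V - N\<close> has size \<open>card V div 2\<close>
    serves as \<open>P\<close>.\<close>
  then show ?thesis using half that[of N] that[of "V - N"] N b by auto
qed

section \<open>Bounding the paths of each length by induction\<close>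

text \<open>By triangle-freeness, \<open>x # y # p\<close> and \<open>y # x # p\<close> cannot both be paths, so among the pairs of
  an arc \<open>(x, y)\<close> and a path \<open>p\<close> avoiding it, at most half extend to a path.\<close>

lemma card_paths_Suc_Suc_le:
  assumes V: "finite V"
  shows "2 * card (paths E V (Suc (Suc (Suc k))))
           \<le> (\<Sum>(x, y)\<in>arcs E V. card (paths E (V - {x, y}) (Suc k)))"
proof -
  let ?T = "SIGMA a:arcs E V. paths E (V - {fst a, snd a}) (Suc k)"
  let ?P = "paths E V (Suc (Suc (Suc k)))"
  \<comment> \<open>\<open>f\<close> and \<open>g\<close> split the first two vertices off as an
    arc, in the two possible directions, and keep the rest of the path.\<close>
  define f where "f = (\<lambda>p::'a list. ((p ! 0, p ! 1), drop 2 p))"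
  define g where "g = (\<lambda>p::'a list. ((p ! 1, p ! 0), drop 2 p))"
  have shape: "\<exists>x y z q. p = x # y # z # q" if "p \<in> ?P" for p
    using that by (auto simp: paths_def length_Suc_conv)
  have "f p \<in> ?T \<and> g p \<in> ?T" if p: "p \<in> ?P" for p
  proof -
    obtain x y z q where "p = x # y # z # q" using shape[OF p] by blast
    then show ?thesis using p sym by (auto simp: f_def g_def paths_def arcs_def)
  qed
  then have sub: "f ` ?P \<subseteq> ?T" "g ` ?P \<subseteq> ?T" by blast+
  \<comment> \<open>If \<open>f p = g p'\<close>, then \<open>p\<close> starts with
    \<open>x, y, z\<close> and \<open>p'\<close> with \<open>y, x, z\<close>, so \<open>x\<close>,
    \<open>y\<close>, \<open>z\<close> form a triangle. This is why the paths need a third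
    vertex.\<close>
  have disj: "f ` ?P \<inter> g ` ?P = {}"
  proof -
    have False if pp: "p \<in> ?P" "p' \<in> ?P" "f p = g p'" for p p'
    proof -
      obtain x y z q x' y' z' q' where "p = x # y # z # q" "p' = x' # y' # z' # q'"
        using shape[OF pp(1)] shape[OF pp(2)] by blast
      then show False
        using that no_triangle[of x y z] by (auto simp: f_def g_def paths_def)
    qed
    then show ?thesis by blast
  qed
  have "p = p'" if pp: "p \<in> ?P" "p' \<in> ?P" "f p = f p' \<or> g p = g p'" for p p'
  proof -
    obtain x y z q x' y' z' q' where "p = x # y # z # q" "p' = x' # y' # z' # q'"
      using shape[OF pp(1)] shape[OF pp(2)] by blast
    then show ?thesis using that by (auto simp: f_def g_def)
  qed
  then have inj: "inj_on f ?P" "inj_on g ?P" by (auto intro!: inj_onI)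
  have fin: "finite ?P" "finite ?T"
    using V by (auto intro!: finite_paths finite_SigmaI finite_arcs)
  have "card ?P + card ?P = card (f ` ?P) + card (g ` ?P)" using inj by (simp add: card_image)
  also have "\<dots> = card (f ` ?P \<union> g ` ?P)"
    using fin disj by (intro card_Un_disjoint[symmetric]) auto
  also have "\<dots> \<le> card ?T" using fin sub by (intro card_mono) simp_all
  also have "card ?T = (\<Sum>a\<in>arcs E V. card (paths E (V - {fst a, snd a}) (Suc k)))"
    by (rule card_SigmaI) (use V in \<open>auto intro!: finite_paths finite_arcs\<close>)
  finally show ?thesis by (simp add: case_prod_unfold)
qed

lemma card_paths_Suc_0: "card (paths E V (Suc 0)) = card V"
proof -
  have "paths E V (Suc 0) = (\<lambda>x. [x]) ` V" by (auto simp: paths_def length_Suc_conv)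
  then show ?thesis by (simp add: card_image inj_on_def)
qed

lemma card_paths_2: "card (paths E V (Suc (Suc 0))) = card (arcs E V)"
proof -
  have "paths E V (Suc (Suc 0)) = (\<lambda>(x, y). [x, y]) ` arcs E V"
    using irrefl by (auto simp: paths_def arcs_def length_Suc_conv)
  then show ?thesis by (simp add: card_image inj_on_def case_prod_unfold prod_eq_iff)
qed

lemma card_paths_le:
  assumes "finite V"
  shows "card (paths E V (Suc k)) \<le> bip_count (card V) (Suc k)"
  using assms
proof (induction k arbitrary: V rule: less_induct)
  case (less k)
  \<comment> \<open>Splitting off an arc requires at least three vertices, that is
    \<open>k \<ge> 2\<close>. Single vertices and arcs are the base cases, the latter by Mantel's
    theorem.\<close>
  consider "k = 0" | "k = Suc 0" | j where "k = Suc (Suc j)" by (cases k rule: nat.exhaust) (metis not0_implies_Suc)+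
  then show ?case
  proof cases
    case 1
    then show ?thesis by (simp add: card_paths_Suc_0 bip_count_Suc_0)
  next
    case 2
    have "bip_count (card V) (Suc (Suc 0)) = 2 * (card V * card V div 4)"
      by (simp add: bip_count_Suc_Suc) (simp add: bip_count_def)
    then show ?thesis using 2 card_arcs_le[OF less.prems] by (simp add: card_paths_2)
  next
    case 3
    let ?b = "bip_count (card V - 2) (Suc j)"
    have step: "card (paths E (V - {x, y}) (Suc j)) \<le> ?b" if "(x, y) \<in> arcs E V" for x y
    proof -
      have "x \<noteq> y" "x \<in> V" "y \<in> V" using that no_triangle by (auto simp: arcs_def)
      then have "card (V - {x, y}) = card V - 2"
        using less.prems by (simp add: card_Diff_subset)
      then show ?thesis using less.IH[of j "V - {x, y}"] 3 less.prems by simp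
    qed
    have "2 * card (paths E V (Suc k))
        \<le> (\<Sum>(x, y)\<in>arcs E V. card (paths E (V - {x, y}) (Suc j)))"
      using card_paths_Suc_Suc_le[OF less.prems, of j] 3 by simp
    also have "\<dots> \<le> (\<Sum>(x, y)\<in>arcs E V. ?b)"
      by (rule sum_mono) (use step in auto)
    also have "\<dots> = card (arcs E V) * ?b" by (simp add: case_prod_unfold)
    also have "\<dots> \<le> 2 * (card V * card V div 4) * ?b"
      by (rule mult_right_mono[OF card_arcs_le[OF less.prems]]) simp
    finally show ?thesis using 3 by (simp add: bip_count_Suc_Suc)
  qed
qed

end

section \<open>The extremal graph and invariance under isomorphism\<close>

lemma adj_triangle_free:
  "triangle_free G \<Longrightarrow> triangle_free_relation (adj G)"
  by unfold_locales (auto simp: adj_def triangle_free_def insert_commute)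

abbreviation turan :: "nat \<Rightarrow> nat ugraph" where
  "turan n \<equiv> complete_bipartite (n div 2) ((n + 1) div 2)"

text \<open>The extremal graph is itself triangle-free, so the general bound applies to it; the
  alternating lists supply the matching lower bound.\<close>

lemma card_paths_turan:
  "card (paths (adj (turan n)) (verts (turan n)) (Suc k)) = bip_count n (Suc k)"
proof (rule antisym)
  let ?a = "n div 2" and ?b = "(n + 1) div 2"
  have n: "?a + ?b = n" by presburger
  have V: "verts (turan n) = {..<?a} \<union> {?a..<?a + ?b}" by (auto simp: complete_bipartite_def)
  interpret triangle_free_relation "adj (turan n)"
    by (intro adj_triangle_free triangle_free_complete_bipartite)
  show "card (paths (adj (turan n)) (verts (turan n)) (Suc k)) \<le> bip_count n (Suc k)"
    using card_paths_le[of "verts (turan n)" k] order_complete_bipartite[of ?a ?b] n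
    by (simp add: order_def complete_bipartite_def)
  have "alt_count (card {..<?a}) (card {?a..<?a + ?b}) (Suc k)
      + alt_count (card {?a..<?a + ?b}) (card {..<?a}) (Suc k)
      \<le> card (paths (adj (turan n)) ({..<?a} \<union> {?a..<?a + ?b}) (Suc k))"
    by (rule card_paths_bipartite_ge) (auto simp: adj_def complete_bipartite_def)
  then show "bip_count n (Suc k) \<le> card (paths (adj (turan n)) (verts (turan n)) (Suc k))"
    unfolding V bip_count_def by simp
qed

text \<open>Bijections of the two parts glue to one of the vertex sets, and adjacency on either side
  depends only on the parts of the two ends.\<close>

lemma bipartite_imp_graph_iso:
  assumes G: "simple_graph G" and P: "P \<subseteq> verts G" "card P = a" "card (verts G - P) = b"
    and E: "\<And>x y. x \<in> verts G \<Longrightarrow> y \<in> verts G \<Longrightarrow> adj G x y \<longleftrightarrow> (x \<in> P \<longleftrightarrow> y \<notin> P)"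
  shows "graph_iso G (complete_bipartite a b)"
proof -
  have fin: "finite (verts G)" using G by (simp add: simple_graph_def)
  have "finite P" using P fin finite_subset by blast
  then obtain f where f: "bij_betw f P {..<a}"
    using P(2) by (metis bij_betw_iff_card card_lessThan finite_lessThan)
  obtain g where g: "bij_betw g (verts G - P) {a..<a + b}"
    using P(3) fin
    by (metis add_diff_cancel_left' bij_betw_iff_card card_atLeastLessThan finite_Diff finite_atLeastLessThan)
  define h where "h = (\<lambda>x. if x \<in> P then f x else g x)"
  have h1: "h x < a" if "x \<in> P" for x using f that by (auto simp: h_def bij_betw_def)
  have h2: "a \<le> h x \<and> h x < a + b" if "x \<in> verts G" "x \<notin> P" for x
    using g that by (auto simp: h_def bij_betw_def)
  have "bij_betw h (P \<union> (verts G - P)) ({..<a} \<union> {a..<a + b})"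
    unfolding h_def by (rule bij_betw_disjoint_Un[OF f g]) auto
  moreover have "P \<union> (verts G - P) = verts G" "{..<a} \<union> {a..<a + b} = {..<a + b}"
    using P by auto
  ultimately have "bij_betw h (verts G) (verts (complete_bipartite a b))"
    by (simp add: complete_bipartite_def)
  moreover have "{u, v} \<in> edges G \<longleftrightarrow> {h u, h v} \<in> edges (complete_bipartite a b)"
    if "u \<in> verts G" "v \<in> verts G" for u v
  proof -
    have "{h u, h v} \<in> edges (complete_bipartite a b) \<longleftrightarrow>
        h u < a \<and> a \<le> h v \<and> h v < a + b \<or> h v < a \<and> a \<le> h u \<and> h u < a + b"
      by (auto simp: complete_bipartite_def doubleton_eq_iff)
    also have "\<dots> \<longleftrightarrow> (u \<in> P \<longleftrightarrow> v \<notin> P)"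
      using h1 h2 that by (metis leD)
    finally show ?thesis using E[OF that] by (simp add: adj_def)
  qed
  ultimately show ?thesis unfolding graph_iso_def by blast
qed

lemma graph_iso_card_paths_eq:
  assumes "graph_iso G H"
  shows "card (paths (adj G) (verts G) k) = card (paths (adj H) (verts H) k)"
proof -
  obtain f where f: "bij_betw f (verts G) (verts H)"
    and e: "\<And>u v. u \<in> verts G \<Longrightarrow> v \<in> verts G \<Longrightarrow> adj G u v \<longleftrightarrow> adj H (f u) (f v)"
    using assms unfolding graph_iso_def adj_def by blast
  have bij: "bij_betw (map f) {xs. set xs \<subseteq> verts G} {xs. set xs \<subseteq> verts H}"
    using bij_lists[OF f] by (simp add: lists_eq_set)
  have iff: "map f xs \<in> paths (adj H) (verts H) k \<longleftrightarrow> xs \<in> paths (adj G) (verts G) k"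
    if "set xs \<subseteq> verts G" for xs
  proof -
    have "successively (adj H) (map f xs) \<longleftrightarrow> successively (adj G) xs"
      unfolding successively_iff_nth using e that by (auto simp: subset_iff)
    moreover have "inj_on f (set xs)" "f ` set xs \<subseteq> verts H"
      using f that by (auto simp: bij_betw_def intro: inj_on_subset)
    ultimately show ?thesis using that by (simp add: paths_def distinct_map)
  qed
  have subG: "paths (adj G) (verts G) k \<subseteq> {xs. set xs \<subseteq> verts G}"
    and subH: "paths (adj H) (verts H) k \<subseteq> {xs. set xs \<subseteq> verts H}"
    by (auto simp: paths_def)
  have "map f ` paths (adj G) (verts G) k = paths (adj H) (verts H) k"
  proof (intro subset_antisym subsetI)
    fix ys assume "ys \<in> map f ` paths (adj G) (verts G) k"
    then show "ys \<in> paths (adj H) (verts H) k" using iff subG by auto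
  next
    fix ys assume ys: "ys \<in> paths (adj H) (verts H) k"
    then have "ys \<in> map f ` {xs. set xs \<subseteq> verts G}"
      using subH unfolding bij_betw_imp_surj_on[OF bij] by (rule rev_subsetD)
    then obtain xs where "ys = map f xs" "set xs \<subseteq> verts G" by auto
    then show "ys \<in> map f ` paths (adj G) (verts G) k" using iff ys by auto
  qed
  then have "bij_betw (map f) (paths (adj G) (verts G) k) (paths (adj H) (verts H) k)"
    by (rule bij_betw_subset[OF bij subG])
  then show ?thesis by (rule bij_betw_same_card)
qed

theorem theorem3:
  fixes G :: "'a ugraph" and n :: nat
  assumes "n \<ge> 1"
    and "simple_graph G"
    and "order G = n"
    and "triangle_free G"
  shows "pn G \<le> pn (complete_bipartite (n div 2) ((n + 1) div 2)) \<and>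
    (pn G = pn (complete_bipartite (n div 2) ((n + 1) div 2)) \<longleftrightarrow>
      graph_iso G (complete_bipartite (n div 2) ((n + 1) div 2)))"
proof -
  interpret triangle_free_relation "adj G" by (rule adj_triangle_free) fact
  have fin: "finite (verts G)" and card: "card (verts G) = n"
    using assms by (auto simp: simple_graph_def order_def)
  have K: "simple_graph (turan n)" by (rule simple_graph_complete_bipartite)
  have ordK: "order (turan n) = n" unfolding order_complete_bipartite by presburger
  \<comment> \<open>The list bound transfers to subgraph counts because both graphs share the same
    positive multiplicity, which cancels.\<close>
  have len_le: "pn_len i G \<le> pn_len i (turan n)" for i
    using card_paths_le[OF fin, of i] card card_paths_turan[of n i] card_paths_eq[OF K, of i]
      card_paths_eq[OF assms(2), of i] card_list_reps_path_graph_pos[of "Suc i"]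
    by simp
  then have le: "pn G \<le> pn (turan n)"
    unfolding pn_def ordK assms(3) by (intro sum_mono)
  have "graph_iso G (turan n)" if eq: "pn G = pn (turan n)"
  proof -
    have "card (arcs (adj G) (verts G)) = 2 * (n * n div 4)"
    \<comment> \<open>For \<open>n = 1\<close> the sum in \<open>pn\<close> has no term of index 1;
      there both sides of the goal are 0.\<close>
    proof (cases "n = 1")
      case True
      then show ?thesis using card_arcs_le[OF fin] card by simp
    next
      case False
      \<comment> \<open>Equal sums with termwise inequality have equal terms; the term of index 1
        counts the edges.\<close>
      then have "pn_len 1 G = pn_len 1 (turan n)"
        using eq sum_mono_inv[of "\<lambda>i. pn_len i G" "{..<n}" "\<lambda>i. pn_len i (turan n)" 1] len_le assms(1)
        unfolding pn_def ordK assms(3) by simp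
      then have "card (paths (adj G) (verts G) (Suc (Suc 0))) = bip_count n (Suc (Suc 0))"
        using card_paths_turan[of n 1] card_paths_eq[OF K, of 1] card_paths_eq[OF assms(2), of 1]
        by simp
      then show ?thesis
        by (simp add: card_paths_2 bip_count_Suc_Suc) (simp add: bip_count_def)
    qed
    then obtain P where P: "P \<subseteq> verts G" "card P = n div 2"
      "\<And>x y. x \<in> verts G \<Longrightarrow> y \<in> verts G \<Longrightarrow> adj G x y \<longleftrightarrow> (x \<in> P \<longleftrightarrow> y \<notin> P)"
      using card_arcs_eq_imp_bipartite[OF fin] card by metis
    have "card (verts G - P) = n - n div 2"
      using P fin card by (metis card_Diff_subset finite_subset)
    also have "\<dots> = (n + 1) div 2" by presburger
    finally show ?thesis using bipartite_imp_graph_iso[OF assms(2) P(1,2)] P(3) by blast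
  qed
  moreover have "pn G = pn (turan n)" if iso: "graph_iso G (turan n)"
  proof -
    have "pn_len i G = pn_len i (turan n)" for i
      using graph_iso_card_paths_eq[OF iso, of "Suc i"] card_paths_eq[OF K, of i]
        card_paths_eq[OF assms(2), of i] card_list_reps_path_graph_pos[of "Suc i"] by simp
    then show ?thesis unfolding pn_def ordK assms(3) by simp
  qed
  ultimately show ?thesis using le by blast
qed

end
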